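(* Let $ABC$ be a triangle. Draw lines $l_A, l_B, l_C$ through the vertices $A, B, C$ respectively, and let $l'_A, l'_B, l'_C$ be the lines symmetric to $l_A, l_B, l_C$ with respect to the bisectors of the angles $A, B, C$ of the triangle, respectively. Let $A_1, A'_1$ be the intersection points of $l_A, l'_A$ with the line $BC$, let $B_1, B'_1$ be the intersection points of $l_B, l'_B$ with the line $AC$, and let $C_1, C'_1$ be the intersection points of $l_C, l'_C$ with the line $AB$. Then the points $A_1, A'_1, B_1, B'_1, C_1, C'_1$ lie on the same conic.
   Context: The setting is the Euclidean plane. All objects are defined in the claim. *)

theory Defs
  imports "HOL-Analysis.Analysis"
begin

definition is_line :: "(real^2) set \<Rightarrow> bool" where
  "is_line l \<longleftrightarrow> affine l \<and> aff_dim l = 1"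

abbreviation line_through :: "real^2 \<Rightarrow> real^2 \<Rightarrow> (real^2) set" where
  "line_through P Q \<equiv> affine hull {P, Q}"

text \<open>The unsigned angle at the middle point, in \<open>[0, \<pi>]\<close>; meaningful only if \<open>P \<noteq> Q\<close> and \<open>R \<noteq> Q\<close>.\<close>

definition angle :: "real^2 \<Rightarrow> real^2 \<Rightarrow> real^2 \<Rightarrow> real" where
  "angle P Q R = arccos (((P - Q) \<bullet> (R - Q)) / (norm (P - Q) * norm (R - Q)))"

text \<open>The bisector of the angle \<open>BAC\<close> as a full line: the internal bisecting ray (without its
  origin \<open>A\<close>) is the set inside the hull, and the hull extends it to a line.\<close>

definition angle_bisector :: "real^2 \<Rightarrow> real^2 \<Rightarrow> real^2 \<Rightarrow> (real^2) set" where
  "angle_bisector B A C =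
     affine hull {P. P \<noteq> A \<and> angle B A P = angle B A C / 2 \<and> angle P A C = angle B A C / 2}"

text \<open>For a line \<open>m\<close>, \<open>closest_point m X\<close> is the foot of the perpendicular from \<open>X\<close> to \<open>m\<close>, and the
  foot is the midpoint of \<open>X\<close> and its mirror image.\<close>

definition reflect_in :: "(real^2) set \<Rightarrow> real^2 \<Rightarrow> real^2" where
  "reflect_in m X = 2 *\<^sub>R closest_point m X - X"

text \<open>A conic is the zero set of a polynomial of degree exactly 2 in the two coordinates. Degenerate
  conics are included; they cannot be avoided here (take the six points on two of the sides, for
  example when \<open>l\<^sub>A\<close> is the line \<open>AB\<close>).\<close>

definition is_conic :: "(real^2) set \<Rightarrow> bool" where
  "is_conic K \<longleftrightarrow>
     (\<exists>a b c d e f :: real. (a, b, c) \<noteq> (0, 0, 0) \<and>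
        K = {X. a * (X $ 1)\<^sup>2 + b * X $ 1 * X $ 2 + c * (X $ 2)\<^sup>2 + d * X $ 1 + e * X $ 2 + f = 0})"

end

theory Submission
  imports Defs
begin

text \<open>Write a, b, c for the side lengths. If the points on BC are \<open>(1 - p) B + p C\<close> and
  \<open>(1 - p') B + p' C\<close>, isogonality says \<open>p p' b\<^sup>2 = (1 - p) (1 - p') c\<^sup>2\<close>, and similarly on the other
  sides. So in barycentric coordinates the two points are the zeros on the line \<open>x = 0\<close> of
  \<open>y\<^sup>2 / b\<^sup>2 + z\<^sup>2 / c\<^sup>2 - \<kappa> y z\<close> for some \<open>\<kappa>\<close>, unless they are B and C. The three restrictions agree
  at the vertices, hence glue to the conic
  \<open>x\<^sup>2 / a\<^sup>2 + y\<^sup>2 / b\<^sup>2 + z\<^sup>2 / c\<^sup>2 - \<kappa> y z - \<lambda> x z - \<mu> x y = 0\<close>. If on some side the points are the two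
  vertices, then the other two sides form a degenerate conic through all six points.\<close>

section \<open>Linear independence in the plane via the cross product\<close>

definition det2 :: "real^2 \<Rightarrow> real^2 \<Rightarrow> real" where
  "det2 u v = u $ 1 * v $ 2 - u $ 2 * v $ 1"

lemma det2_scaleR: "det2 (a *\<^sub>R u) (b *\<^sub>R v) = a * b * det2 u v"
  by (simp add: det2_def algebra_simps)

lemma parallel_if_det2_eq_0:
  assumes "u \<noteq> 0" "det2 u v = 0"
  shows "\<exists>t. v = t *\<^sub>R u"
proof (cases "u $ 1 = 0")
  case True
  then have "u $ 2 \<noteq> 0"
    using assms(1) by (auto simp: vec_eq_iff forall_2)
  then have "v = (v $ 2 / u $ 2) *\<^sub>R u"
    using True assms(2) by (auto simp: vec_eq_iff forall_2 det2_def)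
  then show ?thesis ..
next
  case False
  then have "v = (v $ 1 / u $ 1) *\<^sub>R u"
    using assms(2) by (auto simp: vec_eq_iff forall_2 det2_def field_simps)
  then show ?thesis ..
qed

lemma distinct_if_not_collinear:
  assumes "\<not> collinear {A, B, C}"
  shows "A \<noteq> B" "A \<noteq> C" "B \<noteq> C"
proof -
  have "{A, B, A} = {A, B}"
    by auto
  then show "A \<noteq> B" "A \<noteq> C" "B \<noteq> C"
    using assms by (auto simp: collinear_2)
qed

lemma det2_neq_0_if_not_collinear:
  assumes "\<not> collinear {A, B, C}"
  shows "det2 (B - A) (C - A) \<noteq> 0"
proof
  assume 0: "det2 (B - A) (C - A) = 0"
  have "B - A \<noteq> 0"
    using assms by auto
  then obtain t where "C - A = t *\<^sub>R (B - A)"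
    using parallel_if_det2_eq_0 0 by blast
  then have "collinear {0, B - A, C - A}"
    by (auto simp: collinear_lemma)
  then have "collinear {B, A, C}"
    by (subst collinear_3[where y = A]) (simp_all add: NO_MATCH_def)
  then show False
    using assms by (simp add: insert_commute)
qed

lemma det2_independent:
  assumes "det2 u v \<noteq> 0" and "a *\<^sub>R u + b *\<^sub>R v = c *\<^sub>R u + d *\<^sub>R v"
  shows "a = c \<and> b = d"
proof -
  have e: "(a - c) * u $ i + (b - d) * v $ i = 0" for i
    using arg_cong[OF assms(2), of "\<lambda>w. w $ i"] by (simp add: algebra_simps)
  \<comment> \<open>Cramer's rule: eliminating one unknown from the two coordinate equations
    isolates the other, multiplied by the determinant.\<close>
  have "(a - c) * det2 u v = v $ 2 * ((a - c) * u $ 1 + (b - d) * v $ 1)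
      - v $ 1 * ((a - c) * u $ 2 + (b - d) * v $ 2)"
    by (simp add: det2_def algebra_simps)
  moreover have "(b - d) * det2 u v = u $ 1 * ((a - c) * u $ 2 + (b - d) * v $ 2)
      - u $ 2 * ((a - c) * u $ 1 + (b - d) * v $ 1)"
    by (simp add: det2_def algebra_simps)
  ultimately have "(a - c) * det2 u v = 0" "(b - d) * det2 u v = 0"
    by (simp_all only: e)
  then show ?thesis
    using assms(1) by simp
qed

lemma det2_sgn_neq_0:
  assumes "\<not> collinear {P, Q, R}"
  shows "det2 (sgn (Q - P)) (sgn (R - P)) \<noteq> 0"
  using distinct_if_not_collinear[OF assms] det2_neq_0_if_not_collinear[OF assms]
  by (simp add: sgn_div_norm det2_scaleR)

section \<open>Angle bisectors, reflections and isogonal lines\<close>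

lemma angle_eq_arccos_sgn: "angle P Q R = arccos (sgn (P - Q) \<bullet> sgn (R - Q))"
  by (simp add: angle_def sgn_div_norm divide_inverse ac_simps)

lemma abs_inner_sgn_le_1: "\<bar>sgn x \<bullet> sgn (y :: 'a :: real_inner)\<bar> \<le> 1"
proof -
  have "\<bar>sgn x \<bullet> sgn y\<bar> \<le> norm (sgn x) * norm (sgn y)"
    by (rule Cauchy_Schwarz_ineq2)
  also have "\<dots> \<le> 1"
    by (simp add: norm_sgn)
  finally show ?thesis .
qed

text \<open>The sum of two unit vectors bisects their angle: its norm is
  \<open>2 * cos (\<theta> / 2)\<close>, and its inner product with either vector is half of its
  squared norm.\<close>

lemma arccos_inner_sum:
  fixes u v :: "'a :: real_inner"
  assumes u: "norm u = 1" and v: "norm v = 1" and nz: "u + v \<noteq> 0"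
  shows "arccos (u \<bullet> sgn (u + v)) = arccos (u \<bullet> v) / 2"
proof -
  define n where "n = norm (u + v)"
  define \<theta> where "\<theta> = arccos (u \<bullet> v)"
  have n: "n > 0"
    using nz by (simp add: n_def)
  have uv: "\<bar>u \<bullet> v\<bar> \<le> 1"
    using Cauchy_Schwarz_ineq2[of u v] u v by simp
  have n2: "n\<^sup>2 = 2 + 2 * (u \<bullet> v)"
    using u v by (simp add: n_def power2_norm_eq_inner inner_add inner_commute norm_eq_1)
  have \<theta>: "0 \<le> \<theta>" "\<theta> \<le> pi" "cos \<theta> = u \<bullet> v"
    using uv by (auto simp: \<theta>_def arccos_lbound arccos_ubound cos_arccos)
  have "u \<bullet> sgn (u + v) = (1 + u \<bullet> v) / n"
    using u by (simp add: sgn_div_norm inner_add norm_eq_1 n_def divide_inverse mult.commute)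
  also have "\<dots> = n / 2"
    using n n2 by (simp add: field_simps power2_eq_square)
  also have "n = 2 * cos (\<theta> / 2)"
  proof (rule power2_eq_imp_eq)
    show "n\<^sup>2 = (2 * cos (\<theta> / 2))\<^sup>2"
      using cos_double_cos[of "\<theta> / 2"] n2 \<theta> by (simp add: power_mult_distrib)
    show "0 \<le> 2 * cos (\<theta> / 2)"
      using \<theta> by (simp add: cos_ge_zero)
  qed (use n in simp)
  finally have "u \<bullet> sgn (u + v) = cos (\<theta> / 2)"
    by simp
  then show ?thesis
    using \<theta> by (simp add: arccos_cos \<theta>_def[symmetric])
qed

text \<open>Turns the definition by half angles into a spanning direction. Equality of the two
  angles already forces \<open>X\<close> onto the line, and the half-angle formula puts the open ray
  into the set.\<close>

lemma angle_bisector_eq: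
  assumes nc: "\<not> collinear {P, Q, R}"
  shows "angle_bisector Q P R = affine hull {P, P + (sgn (Q - P) + sgn (R - P))}"
proof -
  define u where "u = sgn (Q - P)"
  define v where "v = sgn (R - P)"
  define S where "S = {X. X \<noteq> P \<and> angle Q P X = angle Q P R / 2 \<and> angle X P R = angle Q P R / 2}"
  have uv: "norm u = 1" "norm v = 1"
    using distinct_if_not_collinear[OF nc] by (auto simp: u_def v_def norm_sgn)
  have d: "det2 u v \<noteq> 0"
    using det2_sgn_neq_0[OF nc] by (simp add: u_def v_def)
  have s: "u + v \<noteq> 0"
  proof
    assume "u + v = 0"
    then have "v = - u"
      by (simp add: eq_neg_iff_add_eq_0 add.commute)
    then show False using d by (simp add: det2_def)
  qed
  have on_line: "X \<in> affine hull {P, P + (u + v)}" if "X \<in> S" for X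
  proof -
    define w where "w = sgn (X - P)"
    have "arccos (u \<bullet> w) = arccos (w \<bullet> v)"
      using that by (simp add: S_def angle_eq_arccos_sgn u_def v_def w_def)
    then have "u \<bullet> w = w \<bullet> v"
      by (simp add: arccos_eq_iff u_def v_def w_def abs_inner_sgn_le_1)
    then have "(X - P) \<bullet> u = (X - P) \<bullet> v"
      using that by (simp add: S_def w_def sgn_div_norm inner_commute)
    then have 1: "(X - P) $ 1 * (u - v) $ 1 + (X - P) $ 2 * (u - v) $ 2 = 0"
      by (simp add: inner_vec_def sum_2 algebra_simps)
    have "(u + v) \<bullet> (u - v) = 0"
      using uv by (simp add: inner_add inner_diff norm_eq_1 inner_commute)
    then have 2: "(u + v) $ 1 * (u - v) $ 1 + (u + v) $ 2 * (u - v) $ 2 = 0"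
      by (simp add: inner_vec_def sum_2)
    have "(u - v) $ 1 \<noteq> 0 \<or> (u - v) $ 2 \<noteq> 0"
      using d by (auto simp: det2_def)
    \<comment> \<open>By \<open>1\<close> and \<open>2\<close>, both \<open>X - P\<close> and
      \<open>u + v\<close> are orthogonal to the nonzero vector \<open>u - v\<close>, so in the
      plane they are parallel.\<close>
    moreover have "(u - v) $ 1 * det2 (u + v) (X - P) = 0" "(u - v) $ 2 * det2 (u + v) (X - P) = 0"
      using 1 2 unfolding det2_def by algebra+
    ultimately have "det2 (u + v) (X - P) = 0"
      by auto
    then obtain t where "X - P = t *\<^sub>R (u + v)"
      using parallel_if_det2_eq_0 s by blast
    then have "X = P + t *\<^sub>R (u + v)"
      by (simp add: algebra_simps)
    then show ?thesis
      by (auto simp: affine_hull_2_alt)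
  qed
  have in_S: "P + t *\<^sub>R (u + v) \<in> S" if "t > 0" for t
  proof -
    have "arccos (sgn (u + v) \<bullet> v) = arccos (u \<bullet> v) / 2"
      using arccos_inner_sum[of v u] uv s by (simp add: inner_commute add.commute)
    then show ?thesis
      using that s arccos_inner_sum[of u v] uv
      by (simp add: S_def angle_eq_arccos_sgn sgn_scaleR flip: u_def v_def)
  qed
  have "affine hull S = affine hull {P, P + (u + v)}"
  proof
    show "affine hull S \<subseteq> affine hull {P, P + (u + v)}"
      using on_line by (intro hull_minimal) auto
    \<comment> \<open>The vertex \<open>P\<close> is excluded from \<open>S\<close>, so two other
      points of the ray are taken to span the line.\<close>
    have "{P + 1 *\<^sub>R (u + v), P + 2 *\<^sub>R (u + v)} \<subseteq> S"
      using in_S[of 1] in_S[of 2] by simp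
    then have sub: "affine hull {P + (u + v), P + 2 *\<^sub>R (u + v)} \<subseteq> affine hull S"
      by (simp add: hull_mono)
    have "P + t *\<^sub>R (u + v) \<in> affine hull {P + (u + v), P + 2 *\<^sub>R (u + v)}" for t
      unfolding affine_hull_2_alt
      by (rule image_eqI[where x = "t - 1"]) (simp_all add: algebra_simps scaleR_2)
    with sub show "affine hull {P, P + (u + v)} \<subseteq> affine hull S"
      unfolding affine_hull_2_alt[of P] by auto
  qed
  then show ?thesis
    by (simp add: angle_bisector_def S_def u_def v_def)
qed

text \<open>For unit vectors, \<open>u + v\<close> and \<open>u - v\<close> are orthogonal, so the
  reflection fixes the first and negates the second; this exchanges \<open>u\<close> and
  \<open>v\<close>. The foot \<open>F\<close> is obtained by averaging the two coordinates.\<close>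

lemma reflect_in_angle_bisector:
  assumes nc: "\<not> collinear {P, Q, R}"
  shows "reflect_in (angle_bisector Q P R) (P + (x *\<^sub>R sgn (Q - P) + y *\<^sub>R sgn (R - P))) =
    P + (y *\<^sub>R sgn (Q - P) + x *\<^sub>R sgn (R - P))"
proof -
  define u where "u = sgn (Q - P)"
  define v where "v = sgn (R - P)"
  define L where "L = affine hull {P, P + (u + v)}"
  define X where "X = P + (x *\<^sub>R u + y *\<^sub>R v)"
  define F where "F = P + ((x + y) / 2) *\<^sub>R (u + v)"
  have uv: "u \<bullet> u = 1" "v \<bullet> v = 1"
    using distinct_if_not_collinear[OF nc] by (auto simp: u_def v_def norm_sgn simp flip: norm_eq_1)
  have closest: "dist X F \<le> dist X Z" if Z: "Z \<in> L" for Z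
  proof -
    obtain t where t: "Z = P + t *\<^sub>R (u + v)"
      using Z by (auto simp: L_def affine_hull_2_alt)
    have XF: "X - F = ((x - y) / 2) *\<^sub>R (u - v)"
      by (simp add: X_def F_def vec_eq_iff field_simps)
    have FZ: "F - Z = ((x + y) / 2 - t) *\<^sub>R (u + v)"
      by (simp add: t F_def algebra_simps)
    have "(X - F) \<bullet> (F - Z) = 0"
      unfolding XF FZ using uv by (simp add: inner_add inner_diff inner_commute)
    then have "(norm (X - Z))\<^sup>2 = (norm (X - F))\<^sup>2 + (norm (F - Z))\<^sup>2"
      using norm_add_Pythagorean[of "X - F" "F - Z"] by (simp add: orthogonal_def)
    then have "(norm (X - F))\<^sup>2 \<le> (norm (X - Z))\<^sup>2"
      by simp
    then show ?thesis
      unfolding dist_norm by (rule power2_le_imp_le) simp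
  qed
  have "F \<in> L"
    by (auto simp: F_def L_def affine_hull_2_alt)
  then have "F = closest_point L X"
    using closest by (intro closest_point_unique) (auto simp: L_def affine_imp_convex)
  then have "reflect_in L X = 2 *\<^sub>R F - X"
    by (simp add: reflect_in_def)
  also have "\<dots> = P + (y *\<^sub>R u + x *\<^sub>R v)"
    by (simp add: F_def X_def vec_eq_iff field_simps)
  finally show ?thesis
    by (simp add: angle_bisector_eq[OF nc] L_def X_def u_def v_def)
qed

lemma is_line_eq_affine_hull:
  assumes "is_line l" "P \<in> l" "X \<in> l" "X \<noteq> P"
  shows "l = affine hull {P, X}"
proof -
  have "affine hull {P, X} \<subseteq> l"
    using assms by (intro hull_minimal) (auto simp: is_line_def)
  then show ?thesis
    using assms affine_dim_equal[of "affine hull {P, X}" l] by (auto simp: is_line_def)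
qed

text \<open>The reflection swaps the coordinates with respect to the unit vectors along the two sides,
  hence the product of the slope ratios \<open>s |PR| : (1 - s) |PQ|\<close> of two isogonal lines is 1.\<close>

lemma isogonal_points:
  assumes nc: "\<not> collinear {P, Q, R}"
    and l: "is_line l" "P \<in> l"
    and l': "l' = reflect_in (angle_bisector Q P R) ` l"
    and X: "l \<inter> line_through Q R = {X}"
    and X': "l' \<inter> line_through Q R = {X'}"
  obtains s s' where "X = (1 - s) *\<^sub>R Q + s *\<^sub>R R" "X' = (1 - s') *\<^sub>R Q + s' *\<^sub>R R"
    "s * s' * (dist P R)\<^sup>2 = (1 - s) * (1 - s') * (dist P Q)\<^sup>2"
proof -
  define u where "u = sgn (Q - P)"
  define v where "v = sgn (R - P)"
  define q where "q = dist P Q"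
  define r where "r = dist P R"
  have "Q \<noteq> P" "R \<noteq> P" "Q \<noteq> R"
    using distinct_if_not_collinear[OF nc] by auto
  then have Q: "Q - P = q *\<^sub>R u" and R: "R - P = r *\<^sub>R v"
    by (auto simp: u_def v_def q_def r_def sgn_div_norm dist_norm norm_minus_commute)
  have P: "P \<notin> line_through Q R"
    using nc collinear_3_affine_hull[OF \<open>Q \<noteq> R\<close>, of P] by (auto simp: insert_commute)
  have on_QR: "\<exists>s. Y = (1 - s) *\<^sub>R Q + s *\<^sub>R R" if Y: "Y \<in> line_through Q R" for Y
  proof -
    obtain s where "Y = Q + s *\<^sub>R (R - Q)"
      using Y by (auto simp: affine_hull_2_alt)
    then have "Y = (1 - s) *\<^sub>R Q + s *\<^sub>R R"
      by (simp add: algebra_simps)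
    then show ?thesis ..
  qed
  have comb: "(1 - s) *\<^sub>R Q + s *\<^sub>R R = P + (((1 - s) * q) *\<^sub>R u + (s * r) *\<^sub>R v)" for s
  proof -
    have "(1 - s) *\<^sub>R Q + s *\<^sub>R R = P + ((1 - s) *\<^sub>R (Q - P) + s *\<^sub>R (R - P))"
      by (simp add: algebra_simps)
    then show ?thesis
      by (simp only: Q R scaleR_scaleR)
  qed
  have XX: "X \<in> l" "X \<in> line_through Q R" "X' \<in> l'" "X' \<in> line_through Q R"
    using X X' by auto
  obtain s s' where s: "X = (1 - s) *\<^sub>R Q + s *\<^sub>R R" and s': "X' = (1 - s') *\<^sub>R Q + s' *\<^sub>R R"
    using on_QR XX by meson
  have "X \<noteq> P"
    using P XX by auto
  obtain Y where Y: "Y \<in> l" "X' = reflect_in (angle_bisector Q P R) Y"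
    using XX l' by auto
  \<comment> \<open>Since \<open>P\<close> is not on the line \<open>QR\<close>, \<open>X\<close>
    differs from \<open>P\<close>, so \<open>l\<close> is the line \<open>PX\<close> and the
    preimage \<open>Y\<close> of \<open>X'\<close> has coordinates proportional to those of
    \<open>X\<close>.\<close>
  have "Y \<in> affine hull {P, X}"
    using is_line_eq_affine_hull[OF l \<open>X \<in> l\<close> \<open>X \<noteq> P\<close>] Y by simp
  then obtain t where "Y = P + t *\<^sub>R (X - P)"
    by (auto simp: affine_hull_2_alt)
  then have "Y = P + ((t * ((1 - s) * q)) *\<^sub>R u + (t * (s * r)) *\<^sub>R v)"
    by (simp add: s comb scaleR_add_right)
  then have "X' = P + ((t * (s * r)) *\<^sub>R u + (t * ((1 - s) * q)) *\<^sub>R v)"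
    using Y reflect_in_angle_bisector[OF nc] by (simp add: u_def v_def)
  then have "((1 - s') * q) *\<^sub>R u + (s' * r) *\<^sub>R v = (t * (s * r)) *\<^sub>R u + (t * ((1 - s) * q)) *\<^sub>R v"
    by (simp add: s' comb)
  then have "(1 - s') * q = t * (s * r)" "s' * r = t * ((1 - s) * q)"
    using det2_independent det2_sgn_neq_0[OF nc] unfolding u_def v_def by blast+
  then have "s * s' * r\<^sup>2 = (1 - s) * (1 - s') * q\<^sup>2"
    by algebra
  then show ?thesis
    using that s s' by (simp add: q_def r_def)
qed

section \<open>Conics in barycentric coordinates\<close>

text \<open>A direction \<open>(x0, y0, z0)\<close>, i.e. a point at infinity, outside the conic ensures that the
  equation in Cartesian coordinates still has degree 2.\<close>

lemma conic_of_barycentric: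
  fixes A B C :: "real^2" and \<alpha> \<beta> \<gamma> \<delta> \<epsilon> \<zeta> :: real
  defines "q \<equiv> \<lambda>x y z. \<alpha> * x\<^sup>2 + \<beta> * y\<^sup>2 + \<gamma> * z\<^sup>2 + \<delta> * y * z + \<epsilon> * x * z + \<zeta> * x * y"
  assumes nc: "\<not> collinear {A, B, C}"
    and inf: "x0 + y0 + z0 = 0" "q x0 y0 z0 \<noteq> 0"
  obtains K where "is_conic K" "\<And>x y z. x + y + z = 1 \<Longrightarrow> q x y z = 0 \<Longrightarrow> x *\<^sub>R A + y *\<^sub>R B + z *\<^sub>R C \<in> K"
proof -
  define D where "D = det2 (B - A) (C - A)"
  have D: "D \<noteq> 0"
    using det2_neq_0_if_not_collinear[OF nc] by (simp add: D_def)
  \<comment> \<open>These are the cofactors of the matrix with columns \<open>(A, 1)\<close>,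
    \<open>(B, 1)\<close>, \<open>(C, 1)\<close>; they invert the passage from barycentric to
    Cartesian coordinates up to the factor \<open>D\<close>.\<close>
  define ax ay az where "ax = B $ 2 - C $ 2" and "ay = C $ 2 - A $ 2" and "az = A $ 2 - B $ 2"
  define bx by' bz where "bx = C $ 1 - B $ 1" and "by' = A $ 1 - C $ 1" and "bz = B $ 1 - A $ 1"
  define cx cy cz where "cx = B $ 1 * C $ 2 - B $ 2 * C $ 1" and "cy = C $ 1 * A $ 2 - C $ 2 * A $ 1"
    and "cz = A $ 1 * B $ 2 - A $ 2 * B $ 1"
  note defs = ax_def ay_def az_def bx_def by'_def bz_def cx_def cy_def cz_def
  have lin: "ax * X $ 1 + bx * X $ 2 + (x + y + z) * cx = D * x"
    "ay * X $ 1 + by' * X $ 2 + (x + y + z) * cy = D * y"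
    "az * X $ 1 + bz * X $ 2 + (x + y + z) * cz = D * z"
    if "X = x *\<^sub>R A + y *\<^sub>R B + z *\<^sub>R C" for X x y z
    unfolding defs that D_def det2_def by (simp_all add: algebra_simps)
  have q_scale: "q (D * x) (D * y) (D * z) = D\<^sup>2 * q x y z" for x y z
    by (simp add: q_def power2_eq_square algebra_simps)
  \<comment> \<open>The polar form of \<open>q\<close>, which supplies the mixed terms when
    \<open>q\<close> is applied to a sum.\<close>
  define p where "p r1 r2 r3 s1 s2 s3 = 2 * \<alpha> * r1 * s1 + 2 * \<beta> * r2 * s2 + 2 * \<gamma> * r3 * s3
    + \<delta> * (r2 * s3 + r3 * s2) + \<epsilon> * (r1 * s3 + r3 * s1) + \<zeta> * (r1 * s2 + r2 * s1)"
    for r1 r2 r3 s1 s2 s3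
  define a b c where "a = q ax ay az" and "b = p ax ay az bx by' bz" and "c = q bx by' bz"
  define d e f where "d = p ax ay az cx cy cz" and "e = p bx by' bz cx cy cz" and "f = q cx cy cz"
  \<comment> \<open>The variable \<open>t\<close> homogenizes the equation: \<open>t = 1\<close>
    gives points of the plane, and \<open>t = 0\<close> leaves only the quadratic part, evaluated at
    directions.\<close>
  have expand: "q (ax * X1 + bx * X2 + t * cx) (ay * X1 + by' * X2 + t * cy) (az * X1 + bz * X2 + t * cz)
    = a * X1\<^sup>2 + b * X1 * X2 + c * X2\<^sup>2 + t * d * X1 + t * e * X2 + t\<^sup>2 * f" for X1 X2 t
    unfolding a_def b_def c_def d_def e_def f_def p_def q_def by algebra
  define K where "K = {X :: real^2. a * (X $ 1)\<^sup>2 + b * X $ 1 * X $ 2 + c * (X $ 2)\<^sup>2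
    + d * X $ 1 + e * X $ 2 + f = 0}"
  show ?thesis
  proof
    define V where "V = x0 *\<^sub>R A + y0 *\<^sub>R B + z0 *\<^sub>R C"
    have "a * (V $ 1)\<^sup>2 + b * V $ 1 * V $ 2 + c * (V $ 2)\<^sup>2 = D\<^sup>2 * q x0 y0 z0"
      using expand[of "V $ 1" "V $ 2" 0] lin[OF V_def] by (simp add: inf(1) q_scale)
    then have "(a, b, c) \<noteq> (0, 0, 0)"
      using D inf(2) by auto
    then show "is_conic K"
      unfolding is_conic_def K_def by blast
  next
    fix x y z :: real
    assume xyz: "x + y + z = 1" "q x y z = 0"
    define X where "X = x *\<^sub>R A + y *\<^sub>R B + z *\<^sub>R C"
    have "X \<in> K"
      using expand[of "X $ 1" "X $ 2" 1] lin[OF X_def] by (simp add: xyz q_scale K_def)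
    then show "x *\<^sub>R A + y *\<^sub>R B + z *\<^sub>R C \<in> K"
      by (simp add: X_def)
  qed
qed

section \<open>Choosing the coefficients of the conic\<close>

text \<open>The restriction of the conic to a side is built from its roots: it is the expansion of
  \<open>k * (s * (1 - t) - (1 - s) * t) * (s' * (1 - t) - (1 - s') * t)\<close>.\<close>

lemma barycentric_quadratic_root:
  fixes s s' u v k t :: real
  assumes "u = k * s * s'" "v = k * (1 - s) * (1 - s')" "t \<in> {s, s'}"
  shows "u * (1 - t)\<^sup>2 + v * t\<^sup>2 + - k * (s * (1 - s') + s' * (1 - s)) * t * (1 - t) = 0"
proof -
  have "u * (1 - t)\<^sup>2 + v * t\<^sup>2 + - k * (s * (1 - s') + s' * (1 - s)) * t * (1 - t)
      = k * (s - t) * (s' - t)"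
    unfolding assms(1,2) by (simp add: power2_eq_square algebra_simps)
  then show ?thesis
    using assms(3) by auto
qed

text \<open>Rescales the form with roots \<open>s\<close> and \<open>s'\<close> so that its values
  at the two vertices depend only on side lengths. This makes the forms on adjacent sides agree at
  their common vertex.\<close>

lemma isogonal_scale:
  fixes s s' m n :: real
  assumes "s * s' * n\<^sup>2 = (1 - s) * (1 - s') * m\<^sup>2" "m \<noteq> 0" "n \<noteq> 0" "s * s' \<noteq> 0"
  obtains k where "k \<noteq> 0" "1 / n\<^sup>2 = k * s * s'" "1 / m\<^sup>2 = k * (1 - s) * (1 - s')"
proof
  have "(1 - s) * (1 - s') \<noteq> 0"
    using assms by auto
  then show "1 / (n\<^sup>2 * (s * s')) \<noteq> 0" "1 / n\<^sup>2 = 1 / (n\<^sup>2 * (s * s')) * s * s'"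
    "1 / m\<^sup>2 = 1 / (n\<^sup>2 * (s * s')) * (1 - s) * (1 - s')"
    using assms by (auto simp: field_simps)
qed

theorem theorem4:
  fixes A B C A1 A1' B1 B1' C1 C1' :: "real^2"
    and lA lB lC lA' lB' lC' :: "(real^2) set"
  assumes triangle: "\<not> collinear {A, B, C}"
    and lA: "is_line lA" "A \<in> lA"
    and lB: "is_line lB" "B \<in> lB"
    and lC: "is_line lC" "C \<in> lC"
    and lA': "lA' = reflect_in (angle_bisector B A C) ` lA"
    and lB': "lB' = reflect_in (angle_bisector A B C) ` lB"
    and lC': "lC' = reflect_in (angle_bisector A C B) ` lC"
    and A1: "lA \<inter> line_through B C = {A1}"
    and A1': "lA' \<inter> line_through B C = {A1'}"
    and B1: "lB \<inter> line_through A C = {B1}"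
    and B1': "lB' \<inter> line_through A C = {B1'}"
    and C1: "lC \<inter> line_through A B = {C1}"
    and C1': "lC' \<inter> line_through A B = {C1'}"
  shows "\<exists>K. is_conic K \<and> {A1, A1', B1, B1', C1, C1'} \<subseteq> K"
proof -
  define a b c where "a = dist B C" and "b = dist A C" and "c = dist A B"
  have "A \<noteq> B" "A \<noteq> C" "B \<noteq> C"
    using distinct_if_not_collinear[OF triangle] by auto
  then have abc: "a \<noteq> 0" "b \<noteq> 0" "c \<noteq> 0"
    by (auto simp: a_def b_def c_def)
  have triB: "\<not> collinear {B, A, C}" and triC: "\<not> collinear {C, A, B}"
    using triangle by (simp_all add: insert_commute)
  obtain p p' where p: "A1 = (1 - p) *\<^sub>R B + p *\<^sub>R C" "A1' = (1 - p') *\<^sub>R B + p' *\<^sub>R C"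
    and pp: "p * p' * b\<^sup>2 = (1 - p) * (1 - p') * c\<^sup>2"
    by (rule isogonal_points[OF triangle lA lA' A1 A1']) (simp add: b_def c_def)
  obtain r r' where r: "B1 = (1 - r) *\<^sub>R A + r *\<^sub>R C" "B1' = (1 - r') *\<^sub>R A + r' *\<^sub>R C"
    and rr: "r * r' * a\<^sup>2 = (1 - r) * (1 - r') * c\<^sup>2"
    by (rule isogonal_points[OF triB lB lB' B1 B1']) (simp add: a_def c_def dist_commute)
  obtain s s' where s: "C1 = (1 - s) *\<^sub>R A + s *\<^sub>R B" "C1' = (1 - s') *\<^sub>R A + s' *\<^sub>R B"
    and ss: "s * s' * a\<^sup>2 = (1 - s) * (1 - s') * b\<^sup>2"
    by (rule isogonal_points[OF triC lC lC' C1 C1']) (simp add: a_def b_def dist_commute)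
  \<comment> \<open>Reduces the theorem to finding six coefficients and a direction: each side is
    parametrized by \<open>t\<close> with one barycentric coordinate zero.\<close>
  have goal: ?thesis if inf: "x0 + y0 + z0 = 0"
      "\<alpha> * x0\<^sup>2 + \<beta> * y0\<^sup>2 + \<gamma> * z0\<^sup>2 + \<delta> * y0 * z0 + \<epsilon> * x0 * z0 + \<zeta> * x0 * y0 \<noteq> 0"
    and rootBC: "\<And>t. t \<in> {p, p'} \<Longrightarrow> \<beta> * (1 - t)\<^sup>2 + \<gamma> * t\<^sup>2 + \<delta> * t * (1 - t) = 0"
    and rootAC: "\<And>t. t \<in> {r, r'} \<Longrightarrow> \<alpha> * (1 - t)\<^sup>2 + \<gamma> * t\<^sup>2 + \<epsilon> * t * (1 - t) = 0"
    and rootAB: "\<And>t. t \<in> {s, s'} \<Longrightarrow> \<alpha> * (1 - t)\<^sup>2 + \<beta> * t\<^sup>2 + \<zeta> * t * (1 - t) = 0"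
    for x0 y0 z0 \<alpha> \<beta> \<gamma> \<delta> \<epsilon> \<zeta>
  proof -
    obtain K where K: "is_conic K" and mem: "\<And>x y z. x + y + z = 1 \<Longrightarrow>
        \<alpha> * x\<^sup>2 + \<beta> * y\<^sup>2 + \<gamma> * z\<^sup>2 + \<delta> * y * z + \<epsilon> * x * z + \<zeta> * x * y = 0 \<Longrightarrow>
        x *\<^sub>R A + y *\<^sub>R B + z *\<^sub>R C \<in> K"
      using conic_of_barycentric[OF triangle inf] by blast
    have "(1 - t) *\<^sub>R B + t *\<^sub>R C \<in> K" if "t \<in> {p, p'}" for t
      using mem[of 0 "1 - t" t] rootBC[OF that] by (simp add: ac_simps)
    moreover have "(1 - t) *\<^sub>R A + t *\<^sub>R C \<in> K" if "t \<in> {r, r'}" for t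
      using mem[of "1 - t" 0 t] rootAC[OF that] by (simp add: ac_simps)
    moreover have "(1 - t) *\<^sub>R A + t *\<^sub>R B \<in> K" if "t \<in> {s, s'}" for t
      using mem[of "1 - t" t 0] rootAB[OF that] by (simp add: ac_simps)
    ultimately show ?thesis
      using K p r s by auto
  qed
  consider "p * p' = 0" | "r * r' = 0" | "s * s' = 0" | "p * p' \<noteq> 0" "r * r' \<noteq> 0" "s * s' \<noteq> 0"
    by blast
  then show ?thesis
  proof cases
    case 1
    \<comment> \<open>By \<open>pp\<close> the product \<open>(1 - p) * (1 - p')\<close> vanishes
      too, so the two points are \<open>B\<close> and \<open>C\<close>. The conic is
      \<open>y * z = 0\<close>, the union of the lines \<open>AC\<close> and \<open>AB\<close>; the
      other two degenerate cases are analogous.\<close>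
    then have "t * (1 - t) = 0" if "t \<in> {p, p'}" for t
      using pp abc that by auto
    then show ?thesis
      by (intro goal[of 0 1 "- 1" 0 0 0 1 0 0]) auto
  next
    case 2
    then have "t * (1 - t) = 0" if "t \<in> {r, r'}" for t
      using rr abc that by auto
    then show ?thesis
      by (intro goal[of 1 0 "- 1" 0 0 0 0 1 0]) auto
  next
    case 3
    then have "t * (1 - t) = 0" if "t \<in> {s, s'}" for t
      using ss abc that by auto
    then show ?thesis
      by (intro goal[of 1 "- 1" 0 0 0 0 0 0 1]) auto
  next
    case 4
    obtain k where k: "k \<noteq> 0" "1 / b\<^sup>2 = k * p * p'" "1 / c\<^sup>2 = k * (1 - p) * (1 - p')"
      using isogonal_scale[OF pp] abc 4 by blast
    obtain l where l: "1 / a\<^sup>2 = l * r * r'" "1 / c\<^sup>2 = l * (1 - r) * (1 - r')"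
      using isogonal_scale[OF rr] abc 4 by blast
    obtain m where m: "1 / a\<^sup>2 = m * s * s'" "1 / b\<^sup>2 = m * (1 - s) * (1 - s')"
      using isogonal_scale[OF ss] abc 4 by blast
    show ?thesis
    proof (rule goal)
      show "0 + 1 + (- 1) = (0 :: real)"
        by simp
      \<comment> \<open>In the direction of \<open>BC\<close> the form takes the value
        \<open>k * (p + (1 - p)) * (p' + (1 - p'))\<close>, which is the nonzero
        \<open>k\<close>.\<close>
      have "1 / b\<^sup>2 + 1 / c\<^sup>2 + k * (p * (1 - p') + p' * (1 - p)) = k"
        unfolding k by (simp add: algebra_simps)
      then show "1 / a\<^sup>2 * 0\<^sup>2 + 1 / b\<^sup>2 * 1\<^sup>2 + 1 / c\<^sup>2 * (- 1)\<^sup>2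
        + - k * (p * (1 - p') + p' * (1 - p)) * 1 * (- 1)
        + - l * (r * (1 - r') + r' * (1 - r)) * 0 * (- 1)
        + - m * (s * (1 - s') + s' * (1 - s)) * 0 * 1 \<noteq> 0"
        using k(1) by simp
    qed (rule barycentric_quadratic_root[OF k(2,3)] barycentric_quadratic_root[OF l]
        barycentric_quadratic_root[OF m], assumption)+
  qed
qed

end
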